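(* Let $G=(V,E)$ be a graph, let $\mathscr{H}$ be the collection of all non-empty subgraphs of $G$, let $w:\mathscr{H}\to\mathbb{R}_+$, and let $\varepsilon>0$. If the weighted graph $G(V,E,w)$ is approximately subadditive (with error $\varepsilon$), then there exists a function $\overline{w}:\mathscr{H}\to\mathbb{R}_+$ such that $G(V,E,\overline{w})$ is a subadditive graph and $\|w-\overline{w}\|<\varepsilon$.
   Context: $\mathbb{R}_+$ denotes the set of positive real numbers. $G=(V,E)$ is a graph with vertex set $V$ and edge set $E$; no restriction is imposed on the cardinalities of $V$ and $E$ (they may be infinite). $\mathscr{H}$ denotes the collection of all non-empty subgraphs of $G$; unions of subgraphs are formed by taking unions of vertex sets and of edge sets. A weight function is a map $w:\mathscr{H}\to\mathbb{R}_+$ assigning a weight to each subgraph, and $G(V,E,w)$ denotes the corresponding weighted graph. For weight functions $w_1,w_2$, $\|w_1-w_2\|=\sup_{H\in\mathscr{H}}|w_1(H)-w_2(H)|$. For fixed $\varepsilon>0$, $G(V,E,w)$ is called approximately subadditive (with error $\varepsilon$) if for every $n\in\mathbb{N}$ ($n\ge 1$) and all $H_1,\dots,H_n\in\mathscr{H}$, with $H=\bigcup_{i=1}^n H_i$, one has $w(H)\leq w(H_1)+\cdots+w(H_n)+\varepsilon$. It is called subadditive if the same inequality holds with $\varepsilon$ replaced by $0$, i.e. $w\left(\bigcup_{i=1}^n H_i\right)\leq w(H_1)+\cdots+w(H_n)$ for every $n\ge 1$ and all $H_1,\dots,H_n\in\mathscr{H}$. *)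

theory Defs
  imports Complex_Main "HOL-Library.FuncSet" "HOL-Library.Uprod"
    "HOL-Library.Extended_Nonnegative_Real"
begin

text \<open>
  A graph consists of a vertex set \<open>V\<close>, an edge set \<open>E\<close> (both of arbitrary cardinality) and an
  incidence function \<open>ends\<close> giving for each edge the unordered pair of its not necessarily distinct
  endpoints. Loops and parallel edges are thus allowed. Simple graphs are the case where the edges
  are themselves unordered pairs of distinct vertices and \<open>ends\<close> is the identity. Values of \<open>ends\<close>
  outside \<open>E\<close> are irrelevant.
\<close>

definition graph :: "'v set \<Rightarrow> 'e set \<Rightarrow> ('e \<Rightarrow> 'v uprod) \<Rightarrow> bool" where
  "graph V E ends \<longleftrightarrow> (\<forall>e\<in>E. set_uprod (ends e) \<subseteq> V)"

text \<open>
  A subgraph inherits the incidence function of the ambient graph, so it is determined by, and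
  represented as, the pair of its vertex set and its edge set. It is non-empty if it has a vertex
  (without vertices there are no edges either).
\<close>

type_synonym ('v, 'e) subgr = "'v set \<times> 'e set"

definition subgraphs :: "'v set \<Rightarrow> 'e set \<Rightarrow> ('e \<Rightarrow> 'v uprod) \<Rightarrow> ('v, 'e) subgr set" where
  "subgraphs V E ends = {(W, F). W \<subseteq> V \<and> F \<subseteq> E \<and> graph W F ends \<and> W \<noteq> {}}"

definition Union_subgr :: "'i set \<Rightarrow> ('i \<Rightarrow> ('v, 'e) subgr) \<Rightarrow> ('v, 'e) subgr" where
  "Union_subgr I H = (\<Union>i\<in>I. fst (H i), \<Union>i\<in>I. snd (H i))"

text \<open>
  Weights are total functions constrained only on \<open>subgraphs V E ends\<close>; all notions below refer only
  to their values there.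
\<close>

definition weight_function ::
  "'v set \<Rightarrow> 'e set \<Rightarrow> ('e \<Rightarrow> 'v uprod) \<Rightarrow> (('v, 'e) subgr \<Rightarrow> real) \<Rightarrow> bool" where
  "weight_function V E ends w \<longleftrightarrow> w \<in> subgraphs V E ends \<rightarrow> {0<..}"

definition approx_subadditive ::
  "real \<Rightarrow> 'v set \<Rightarrow> 'e set \<Rightarrow> ('e \<Rightarrow> 'v uprod) \<Rightarrow> (('v, 'e) subgr \<Rightarrow> real) \<Rightarrow> bool" where
  "approx_subadditive \<epsilon> V E ends w \<longleftrightarrow>
     (\<forall>n::nat. \<forall>H. n \<ge> 1 \<and> (\<forall>i\<in>{1..n}. H i \<in> subgraphs V E ends) \<longrightarrow>
        w (Union_subgr {1..n} H) \<le> (\<Sum>i=1..n. w (H i)) + \<epsilon>)"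

definition subadditive ::
  "'v set \<Rightarrow> 'e set \<Rightarrow> ('e \<Rightarrow> 'v uprod) \<Rightarrow> (('v, 'e) subgr \<Rightarrow> real) \<Rightarrow> bool" where
  "subadditive V E ends w \<longleftrightarrow>
     (\<forall>n::nat. \<forall>H. n \<ge> 1 \<and> (\<forall>i\<in>{1..n}. H i \<in> subgraphs V E ends) \<longrightarrow>
        w (Union_subgr {1..n} H) \<le> (\<Sum>i=1..n. w (H i)))"

text \<open>
  The supremum is taken in \<open>[0, \<infinity>]\<close>: it is \<open>\<infinity>\<close> if the differences are unbounded, and \<open>0\<close> for a graph
  without vertices. A real-valued \<open>SUP\<close> would be unspecified in both cases.
\<close>

definition weight_dist ::
  "'v set \<Rightarrow> 'e set \<Rightarrow> ('e \<Rightarrow> 'v uprod) \<Rightarrow> (('v, 'e) subgr \<Rightarrow> real) \<Rightarrow> (('v, 'e) subgr \<Rightarrow> real)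
     \<Rightarrow> ennreal" where
  "weight_dist V E ends w1 w2 = (SUP H\<in>subgraphs V E ends. ennreal \<bar>w1 H - w2 H\<bar>)"

end

theory Submission imports Defs begin

text \<open>
  Let \<open>u H\<close> be the infimum of \<open>w H\<^sub>1 + \<dots> + w H\<^sub>n\<close> over all finite decompositions of \<open>H\<close>. Concatenating
  decompositions shows that \<open>u\<close> is subadditive, and approximate subadditivity of \<open>w\<close> says
  \<open>w - \<epsilon> \<le> u \<le> w\<close>. Hence \<open>u + \<epsilon>/2\<close> is positive, still subadditive, and within \<open>\<epsilon>/2 < \<epsilon>\<close> of \<open>w\<close>.
\<close>

text \<open>Lists count repeated subgraphs with multiplicity, and concatenating them adds their
  costs.\<close>

definition decompositions ::
  "'v set \<Rightarrow> 'e set \<Rightarrow> ('e \<Rightarrow> 'v uprod) \<Rightarrow> ('v, 'e) subgr \<Rightarrow> ('v, 'e) subgr list set" where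
  "decompositions V E ends H =
     {xs. xs \<noteq> [] \<and> set xs \<subseteq> subgraphs V E ends \<and> Union_subgr (set xs) id = H}"

text \<open>A real \<open>INF\<close> is meaningful only over a non-empty set bounded below. For
  \<open>H\<close> in \<open>subgraphs V E ends\<close> and a positive weight, \<open>[H]\<close>
  provides the former and \<open>0\<close> the latter. The infimum need not be attained.\<close>

definition min_cost ::
  "'v set \<Rightarrow> 'e set \<Rightarrow> ('e \<Rightarrow> 'v uprod) \<Rightarrow> (('v, 'e) subgr \<Rightarrow> real) \<Rightarrow> ('v, 'e) subgr \<Rightarrow> real" where
  "min_cost V E ends w H = (INF xs\<in>decompositions V E ends H. \<Sum>x\<leftarrow>xs. w x)"

lemma singleton_decomposition:
  "H \<in> subgraphs V E ends \<Longrightarrow> [H] \<in> decompositions V E ends H"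
  by (simp add: decompositions_def Union_subgr_def)

lemma concat_decompositions:
  assumes "1 \<le> n" and "\<And>i. i \<in> {1..n} \<Longrightarrow> X i \<in> decompositions V E ends (H i)"
  shows "concat (map X [1..<Suc n]) \<in> decompositions V E ends (Union_subgr {1..n} H)"
proof -
  have X: "X i \<noteq> []" "set (X i) \<subseteq> subgraphs V E ends"
      "H i = (\<Union>x\<in>set (X i). fst x, \<Union>x\<in>set (X i). snd x)" if "i \<in> {1..n}" for i
    using assms(2)[OF that] by (auto simp: decompositions_def Union_subgr_def)
  have set: "set (concat (map X [1..<Suc n])) = (\<Union>i\<in>{1..n}. set (X i))"
    by (simp del: upt_Suc add: atLeastLessThanSuc_atLeastAtMost)
  \<comment> \<open>Since \<open>n\<close> is at least 1, the block \<open>X 1\<close> occurs and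
    keeps the concatenation non-empty.\<close>
  have "1 \<in> {1..n}"
    using assms(1) by simp
  then have "X 1 \<noteq> []" "set (X 1) \<subseteq> set (concat (map X [1..<Suc n]))"
    unfolding set by (rule X(1), rule UN_upper)
  then have "concat (map X [1..<Suc n]) \<noteq> []"
    by (metis set_empty subset_empty)
  moreover have "(\<Union>i\<in>{1..n}. set (X i)) \<subseteq> subgraphs V E ends"
    using X(2) by (rule UN_least)
  moreover have "Union_subgr (\<Union>i\<in>{1..n}. set (X i)) id = Union_subgr {1..n} H"
    using X(3) by (simp add: Union_subgr_def)
  ultimately show ?thesis
    unfolding decompositions_def mem_Collect_eq set by (intro conjI)
qed

lemma sum_list_concat_map_upt:
  fixes w :: "'a \<Rightarrow> real"
  shows "(\<Sum>x\<leftarrow>concat (map X [1..<Suc n]). w x) = (\<Sum>i=1..n. \<Sum>x\<leftarrow>X i. w x)"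
  by (induction n) auto

text \<open>The list is read as a family indexed by \<open>{1..length xs}\<close>, to which the
  hypothesis applies. Taking the infimum over \<open>xs\<close> later gives
  \<open>w - \<epsilon> \<le> u\<close>.\<close>

lemma approx_subadditive_decomposition:
  assumes "approx_subadditive \<epsilon> V E ends w" and "xs \<in> decompositions V E ends H"
  shows "w H \<le> (\<Sum>x\<leftarrow>xs. w x) + \<epsilon>"
proof -
  have xs: "xs \<noteq> []" "set xs \<subseteq> subgraphs V E ends" "Union_subgr (set xs) id = H"
    using assms(2) by (auto simp: decompositions_def)
  \<comment> \<open>List positions start at 0, the families of \<open>approx_subadditive\<close> at
    1.\<close>
  define K where "K i = xs ! (i - 1)" for i
  have "set xs = (\<lambda>i. xs ! i) ` {0..<length xs}"
    by (auto simp: set_conv_nth)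
  also have "\<dots> = K ` Suc ` {0..<length xs}"
    by (simp add: image_image K_def del: image_Suc_atLeastLessThan)
  finally have set: "set xs = K ` {1..length xs}"
    by (simp add: atLeastLessThanSuc_atLeastAtMost)
  have sum: "(\<Sum>x\<leftarrow>xs. w x) = (\<Sum>i=1..length xs. w (K i))"
    unfolding One_nat_def sum.atLeast1_atMost_eq
    by (simp add: sum_list_sum_nth K_def atLeast0LessThan)
  have "length xs \<ge> 1"
    using xs(1) by (simp add: Suc_le_eq)
  moreover have "\<forall>i\<in>{1..length xs}. K i \<in> subgraphs V E ends"
    using xs(2) set by auto
  moreover have "Union_subgr {1..length xs} K = H"
    using xs(3) unfolding set by (simp add: Union_subgr_def image_image)
  ultimately have "w (Union_subgr {1..length xs} K) \<le> (\<Sum>i=1..length xs. w (K i)) + \<epsilon>"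
    using assms(1) unfolding approx_subadditive_def by blast
  then show ?thesis
    unfolding sum \<open>Union_subgr {1..length xs} K = H\<close> .
qed

lemma decomposition_cost_nonneg:
  assumes "weight_function V E ends w" and "xs \<in> decompositions V E ends H"
  shows "0 \<le> (\<Sum>x\<leftarrow>xs. w x)"
proof (rule sum_list_nonneg)
  fix y assume "y \<in> set (map w xs)"
  then show "0 \<le> y"
    using assms by (force simp: decompositions_def weight_function_def Pi_iff)
qed

lemma min_cost_le:
  assumes "weight_function V E ends w" and "xs \<in> decompositions V E ends H"
  shows "min_cost V E ends w H \<le> (\<Sum>x\<leftarrow>xs. w x)"
  unfolding min_cost_def using assms
  by (intro cINF_lower) (auto intro!: bdd_belowI[of _ 0] decomposition_cost_nonneg)

lemma le_min_cost:
  assumes "H \<in> subgraphs V E ends"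
    and "\<And>xs. xs \<in> decompositions V E ends H \<Longrightarrow> c \<le> (\<Sum>x\<leftarrow>xs. w x)"
  shows "c \<le> min_cost V E ends w H"
  unfolding min_cost_def using assms singleton_decomposition[OF assms(1)]
  by (intro cINF_greatest) auto

text \<open>As infima need not be attained, near-optimal decompositions of the \<open>H i\<close>
  are concatenated, with a total excess of at most an arbitrary \<open>\<delta> > 0\<close>.\<close>

lemma min_cost_subadditive:
  assumes "weight_function V E ends w"
  shows "subadditive V E ends (min_cost V E ends w)"
  unfolding subadditive_def
proof (intro allI impI, elim conjE)
  fix n :: nat and H :: "nat \<Rightarrow> ('a, 'b) subgr"
  assume n: "1 \<le> n" and H: "\<forall>i\<in>{1..n}. H i \<in> subgraphs V E ends"
  let ?u = "min_cost V E ends w"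
  show "?u (Union_subgr {1..n} H) \<le> (\<Sum>i=1..n. ?u (H i))"
  proof (rule field_le_epsilon)
    fix \<delta> :: real assume "\<delta> > 0"
    \<comment> \<open>The \<open>n\<close> slacks \<open>\<delta> / n\<close> add up to
      \<open>\<delta>\<close>. If no such list existed, \<open>?u (H i) + \<delta> / n\<close> would
      be a lower bound of the costs exceeding their infimum.\<close>
    have "\<exists>xs\<in>decompositions V E ends (H i). (\<Sum>x\<leftarrow>xs. w x) < ?u (H i) + \<delta> / n"
      if "i \<in> {1..n}" for i
    proof (rule ccontr)
      assume "\<not> ?thesis"
      then have "?u (H i) + \<delta> / n \<le> ?u (H i)"
        using H that by (intro le_min_cost) (auto simp: not_less)
      then show False
        using \<open>\<delta> > 0\<close> n by (simp add: divide_le_0_iff)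
    qed
    then obtain X where X: "X i \<in> decompositions V E ends (H i)"
        "(\<Sum>x\<leftarrow>X i. w x) < ?u (H i) + \<delta> / n" if "i \<in> {1..n}" for i
      by metis
    have "?u (Union_subgr {1..n} H) \<le> (\<Sum>x\<leftarrow>concat (map X [1..<Suc n]). w x)"
      using concat_decompositions[OF n X(1)] by (rule min_cost_le[OF assms])
    also have "\<dots> = (\<Sum>i=1..n. \<Sum>x\<leftarrow>X i. w x)"
      by (rule sum_list_concat_map_upt)
    also have "\<dots> \<le> (\<Sum>i=1..n. ?u (H i) + \<delta> / n)"
      using X(2) by (intro sum_mono) (simp add: less_imp_le)
    also have "\<dots> = (\<Sum>i=1..n. ?u (H i)) + \<delta>"
      using n by (simp add: sum.distrib)
    finally show "?u (Union_subgr {1..n} H) \<le> (\<Sum>i=1..n. ?u (H i)) + \<delta>" .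
  qed
qed

text \<open>The constant enters once on the left and \<open>n \<ge> 1\<close> times on the
  right.\<close>

lemma subadditive_add_const:
  assumes "subadditive V E ends u" and "0 \<le> c"
  shows "subadditive V E ends (\<lambda>H. u H + c)"
  unfolding subadditive_def
proof (intro allI impI)
  fix n :: nat and H
  assume *: "n \<ge> 1 \<and> (\<forall>i\<in>{1..n}. H i \<in> subgraphs V E ends)"
  then have "u (Union_subgr {1..n} H) \<le> (\<Sum>i=1..n. u (H i))"
    using assms(1) unfolding subadditive_def by blast
  moreover have "c \<le> real n * c"
    using * assms(2) by (simp add: mult_le_cancel_right1)
  ultimately show "u (Union_subgr {1..n} H) + c \<le> (\<Sum>i=1..n. u (H i) + c)"
    by (simp add: sum.distrib)
qed

theorem theorem1p2:
  fixes V :: "'v set" and E :: "'e set" and ends :: "'e \<Rightarrow> 'v uprod"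
    and w :: "('v, 'e) subgr \<Rightarrow> real" and \<epsilon> :: real
  assumes "graph V E ends"
    and "weight_function V E ends w"
    and "\<epsilon> > 0"
    and "approx_subadditive \<epsilon> V E ends w"
  shows "\<exists>w' :: ('v, 'e) subgr \<Rightarrow> real.
           weight_function V E ends w' \<and> subadditive V E ends w' \<and>
           weight_dist V E ends w w' < ennreal \<epsilon>"
proof (intro exI conjI)
  let ?u = "min_cost V E ends w"
  \<comment> \<open>The difference \<open>w H - ?u H\<close> lies in \<open>[0, \<epsilon>]\<close>;
    subtracting the midpoint centres it at 0. The shift also gives positivity, as
    \<open>?u H\<close> itself is only known to be non-negative.\<close>
  let ?w' = "\<lambda>H. ?u H + \<epsilon> / 2"
  have nonneg: "0 \<le> ?u H" if "H \<in> subgraphs V E ends" for H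
    using that decomposition_cost_nonneg[OF assms(2)] by (rule le_min_cost)
  have upper: "?u H \<le> w H" if "H \<in> subgraphs V E ends" for H
    using min_cost_le[OF assms(2) singleton_decomposition[OF that]] by simp
  have lower: "w H - \<epsilon> \<le> ?u H" if "H \<in> subgraphs V E ends" for H
    using that approx_subadditive_decomposition[OF assms(4)]
    by (intro le_min_cost) (auto simp: diff_le_eq)
  show "weight_function V E ends ?w'"
    using nonneg assms(3) by (auto simp: weight_function_def intro: add_nonneg_pos)
  show "subadditive V E ends ?w'"
    using min_cost_subadditive[OF assms(2)] assms(3) by (intro subadditive_add_const) auto
  \<comment> \<open>A uniform bound below \<open>\<epsilon>\<close> is used because pointwise strict
    bounds by \<open>\<epsilon>\<close> would only make the supremum at most
    \<open>\<epsilon>\<close>.\<close>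
  have "weight_dist V E ends w ?w' \<le> ennreal (\<epsilon> / 2)"
    unfolding weight_dist_def
  proof (intro SUP_least ennreal_leI)
    fix H assume "H \<in> subgraphs V E ends"
    then show "\<bar>w H - ?w' H\<bar> \<le> \<epsilon> / 2"
      using upper[of H] lower[of H] by (simp add: abs_le_iff field_simps)
  qed
  also have "\<dots> < ennreal \<epsilon>"
    using assms(3) by (simp add: ennreal_less_iff)
  finally show "weight_dist V E ends w ?w' < ennreal \<epsilon>" .
qed

end
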